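(* Let $R(x)=\sum_{n=1}^\infty \frac{\sin(\pi n^2x)}{n^2}$ and $\Phi(x)=\sum_{n=1}^\infty\frac{e^{\pi i n^2x}}{\pi i n^2}$ for $x\in\mathbb{R}$ (both are $2$-periodic). For every real $p\ge 1$, $$\mathcal{V}_p(\Phi;[0,2])<\infty\quad\Longleftrightarrow\quad \mathcal{V}_p(R;[0,2])<\infty.$$
   Context: Let $f:\mathbb{R}\to\mathbb{C}$ be periodic with period $P>0$. For $E\subset\mathbb{R}$ put $\operatorname{osc}(f;E)=\sup_{x,y\in E}|f(x)-f(y)|$. For $1\le p<\infty$ the $p$-variation of $f$ is $$\mathcal{V}_p(f;[0,P])=\sup_{\mathcal{I}}\Big(\sum_{I\in\mathcal{I}}\operatorname{osc}(f;I)^p\Big)^{1/p}\in[0,\infty],$$ where the supremum is over all finite families $\mathcal{I}$ of (pairwise) disjoint intervals contained in $[0,P]$. *)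

theory Defs
  imports "HOL-Analysis.Analysis"
begin

text \<open>
  Suprema are taken in \<^typ>\<open>ennreal\<close>, so that the oscillation and the \<open>p\<close>-variation of an
  arbitrary function take values in \<open>[0,\<infinity>]\<close>, and the supremum over the empty set is \<open>0\<close>.
\<close>

definition osc :: "(real \<Rightarrow> complex) \<Rightarrow> real set \<Rightarrow> ennreal" where
  "osc f E = (SUP (x, y) \<in> E \<times> E. ennreal (cmod (f x - f y)))"

text \<open>Only meant for exponents \<open>a > 0\<close>, where \<open>\<infinity>\<close> to the power \<open>a\<close> is \<open>\<infinity>\<close>.\<close>

definition ennreal_powr :: "ennreal \<Rightarrow> real \<Rightarrow> ennreal" where
  "ennreal_powr x a = (if x = \<infinity> then \<infinity> else ennreal (enn2real x powr a))"

text \<open>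
  The intervals may be open, closed or half-open, and degenerate. A family is encoded as a set of
  intervals: in a pairwise disjoint indexed family only the empty interval could occur repeatedly,
  and its oscillation is \<open>0\<close>.
\<close>

definition interval_families :: "real set \<Rightarrow> real set set set" where
  "interval_families S =
     {\<I>. finite \<I> \<and> disjoint \<I> \<and> (\<forall>I\<in>\<I>. is_interval I \<and> I \<subseteq> S)}"

definition p_variation :: "real \<Rightarrow> (real \<Rightarrow> complex) \<Rightarrow> real \<Rightarrow> ennreal" where
  "p_variation p f P =
     (SUP \<I> \<in> interval_families {0..P}. ennreal_powr (\<Sum>I\<in>\<I>. ennreal_powr (osc f I) p) (1 / p))"

definition riemann_R :: "real \<Rightarrow> real" where
  "riemann_R x = (\<Sum>n. sin (pi * real (Suc n) ^ 2 * x) / real (Suc n) ^ 2)"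

definition riemann_Phi :: "real \<Rightarrow> complex" where
  "riemann_Phi x =
     (\<Sum>n. exp (of_real pi * \<i> * of_nat (Suc n) ^ 2 * of_real x)
            / (of_real pi * \<i> * of_nat (Suc n) ^ 2))"

lemma summable_riemann_R: "summable (\<lambda>n. sin (pi * real (Suc n) ^ 2 * x) / real (Suc n) ^ 2)"
proof (rule summable_comparison_test')
  show "summable (\<lambda>n. 1 / real (Suc n) ^ 2)"
    using inverse_power_summable[of 2, where 'a = real]
    by (subst summable_Suc_iff) (simp add: inverse_eq_divide)
qed (simp add: divide_right_mono del: of_nat_Suc)

lemma summable_riemann_Phi:
  "summable (\<lambda>n. exp (of_real pi * \<i> * of_nat (Suc n) ^ 2 * of_real x)
                  / (of_real pi * \<i> * of_nat (Suc n) ^ 2) :: complex)"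
proof (rule summable_comparison_test')
  have "summable (\<lambda>n. 1 / real (Suc n) ^ 2)"
    using inverse_power_summable[of 2, where 'a = real]
    by (subst summable_Suc_iff) (simp add: inverse_eq_divide)
  then show "summable (\<lambda>n. (1 / pi) * (1 / real (Suc n) ^ 2))"
    by (rule summable_mult)
  show "norm (exp (of_real pi * \<i> * of_nat (Suc n) ^ 2 * of_real x)
          / (of_real pi * \<i> * of_nat (Suc n) ^ 2) :: complex) \<le> (1 / pi) * (1 / real (Suc n) ^ 2)"
    for n
  proof -
    have "Re (of_real pi * \<i> * of_nat (Suc n) ^ 2 * of_real x) = 0"
      by (simp flip: of_nat_power del: of_nat_Suc)
    then show ?thesis
      by (simp add: norm_divide norm_mult norm_power del: of_nat_Suc)
  qed
qed

lemma riemann_R_periodic: "riemann_R (x + 2) = riemann_R x"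
proof -
  have "sin (pi * real (Suc n) ^ 2 * (x + 2)) = sin (pi * real (Suc n) ^ 2 * x)" for n
  proof -
    have "pi * real (Suc n) ^ 2 * (x + 2) = pi * real (Suc n) ^ 2 * x + real (2 * Suc n ^ 2) * pi"
      by (simp add: algebra_simps del: of_nat_Suc)
    then show ?thesis
      by (simp only: sin_add sin_npi cos_npi) simp
  qed
  then show ?thesis
    unfolding riemann_R_def by presburger
qed

lemma riemann_Phi_periodic: "riemann_Phi (x + 2) = riemann_Phi x"
proof -
  have "exp (of_real pi * \<i> * of_nat (Suc n) ^ 2 * of_real (x + 2))
      = (exp (of_real pi * \<i> * of_nat (Suc n) ^ 2 * of_real x) :: complex)" for n
  proof -
    have "of_real pi * \<i> * of_nat (Suc n) ^ 2 * of_real (x + 2)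
        = of_real pi * \<i> * of_nat (Suc n) ^ 2 * of_real x
          + (2 * of_int (int (Suc n ^ 2)) * of_real pi * \<i> :: complex)"
      by (simp add: algebra_simps del: of_nat_Suc)
    moreover have "exp (2 * of_int (int (Suc n ^ 2)) * of_real pi * \<i>) = (1 :: complex)"
      using exp_integer_2pi[of "of_int (int (Suc n ^ 2))"] by (simp del: of_nat_Suc)
    ultimately show ?thesis
      by (simp only: exp_add) simp
  qed
  then show ?thesis
    unfolding riemann_Phi_def by presburger
qed

end

theory Submission
  imports Defs
begin

text \<open>
  Up to the factor \<open>1/\<pi>\<close>, the real and imaginary parts of \<open>\<Phi>\<close> are the sine series \<open>R\<close> and the
  negative of the cosine series \<open>C(x) = \<Sum> cos (\<pi>n\<^sup>2x) / n\<^sup>2\<close>. So finite variation of \<open>\<Phi>\<close>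
  passes to \<open>R\<close>, and the point is to control \<open>C\<close> by \<open>R\<close>.

  For \<open>p > 1\<close> this rests on the identity \<open>C(x) = R(x + 1/2) - R(4x)/4 + C(4x)/4\<close>
  (\<open>riemann_C_quarter_shift\<close>), which expresses that a shift by \<open>1/2\<close> turns the odd sine terms into
  cosine terms and fixes the even ones. Iterated, it writes \<open>C\<close> as a sum of
  \<open>4\<^sup>-\<^sup>k G(4\<^sup>kx)\<close>, where \<open>G(x) = R(x + 1/2) - R(4x)/4\<close>. The function \<open>G(4\<^sup>kx)\<close> runs through
  \<open>4\<^sup>k\<close> periods, so its \<open>p\<close>-variation is of order \<open>4 powr (k / p)\<close>, and the factor
  \<open>4\<^sup>-\<^sup>k\<close> makes the sum converge (\<open>variation_riemann_C\<close>).

  For \<open>p = 1\<close> this series of bounds diverges, but then neither function has finite variation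
  (\<open>riemann_R_not_bounded_variation\<close>). If \<open>R\<close> were of bounded variation, its derivative would be a
  finite measure whose cosine coefficients at all squares are equal and nonzero. A Riesz product whose
  frequencies are rapidly increasing squares is a bounded test function; it meets no other square
  (\<open>riesz_coeff_square\<close>), and its coefficients have an arbitrarily large sum. Testing the measure
  against it gives a contradiction.
\<close>

section \<open>Oscillation of bounded functions as a real number\<close>

definition rosc :: "(real \<Rightarrow> complex) \<Rightarrow> real set \<Rightarrow> real" where
  "rosc f E = enn2real (osc f E)"

lemma rosc_nonneg: "0 \<le> rosc f E"
  by (simp add: rosc_def)

lemma osc_eq_ennreal_rosc:
  assumes "bounded (range f)"
  shows "osc f E = ennreal (rosc f E)"
proof -
  obtain B where B: "cmod (f x) \<le> B" for x
    using assms by (auto simp: bounded_iff)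
  have "cmod (f x - f y) \<le> 2 * B" for x y
    using norm_triangle_ineq4[of "f x" "f y"] B[of x] B[of y] by linarith
  then have "osc f E \<le> ennreal (2 * B)"
    unfolding osc_def by (intro SUP_least) (auto intro: ennreal_leI)
  then have "osc f E \<noteq> \<infinity>"
    by (auto simp: top_unique)
  then show ?thesis
    by (simp add: rosc_def less_top)
qed

lemma le_rosc:
  assumes "bounded (range f)" "x \<in> E" "y \<in> E"
  shows "cmod (f x - f y) \<le> rosc f E"
proof -
  have "ennreal (cmod (f x - f y)) \<le> osc f E"
    unfolding osc_def using assms(2,3) by (intro SUP_upper2[of "(x, y)"]) auto
  then show ?thesis
    using osc_eq_ennreal_rosc[OF assms(1)] by (simp add: rosc_nonneg)
qed

lemma rosc_le:
  assumes "\<And>x y. x \<in> E \<Longrightarrow> y \<in> E \<Longrightarrow> cmod (f x - f y) \<le> c" "0 \<le> c"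
  shows "rosc f E \<le> c"
proof -
  have "osc f E \<le> ennreal c"
    unfolding osc_def using assms(1) by (intro SUP_least) (auto intro: ennreal_leI)
  then show ?thesis
    unfolding rosc_def using assms(2) by (simp add: enn2real_leI)
qed

lemma rosc_linear_combination_le:
  assumes "bounded (range g)" "bounded (range h)" "\<And>x. f x = a * g x + b * h x"
  shows "rosc f E \<le> cmod a * rosc g E + cmod b * rosc h E"
proof (rule rosc_le)
  fix x y assume "x \<in> E" "y \<in> E"
  then have "cmod a * cmod (g x - g y) \<le> cmod a * rosc g E" "cmod b * cmod (h x - h y) \<le> cmod b * rosc h E"
    using assms(1,2) by (auto intro!: mult_left_mono le_rosc)
  moreover have "f x - f y = a * (g x - g y) + b * (h x - h y)"
    by (simp add: assms(3) algebra_simps)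
  then have "cmod (f x - f y) \<le> cmod a * cmod (g x - g y) + cmod b * cmod (h x - h y)"
    by (simp only: norm_mult[symmetric] norm_triangle_ineq)
  ultimately show "cmod (f x - f y) \<le> cmod a * rosc g E + cmod b * rosc h E"
    by linarith
qed (simp add: rosc_nonneg)

lemma rosc_image: "rosc f (h ` E) = rosc (\<lambda>x. f (h x)) E"
proof -
  have "(\<lambda>(x, y). ennreal (cmod (f x - f y))) ` (h ` E \<times> h ` E) =
        (\<lambda>(x, y). ennreal (cmod (f (h x) - f (h y)))) ` (E \<times> E)"
    by (force simp: image_iff)
  then show ?thesis
    by (simp add: rosc_def osc_def)
qed

section \<open>Finite variation and rescaled periodic functions\<close>

text \<open>
  The \<open>p\<close>-th powers are summed without taking a \<open>p\<close>-th root, so \<open>W\<close> bounds the \<open>p\<close>-th power of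
  the \<open>p\<close>-variation. In this form the bounds of adjacent stretches of the line simply add up.
\<close>

definition variation_le :: "real \<Rightarrow> (real \<Rightarrow> complex) \<Rightarrow> real \<Rightarrow> real \<Rightarrow> bool" where
  "variation_le p f P W \<longleftrightarrow>
     (\<forall>\<I>\<in>interval_families {0..P}. (\<Sum>I\<in>\<I>. rosc f I powr p) \<le> W)"

lemma p_variation_finite_iff:
  assumes "bounded (range f)" "p \<ge> 1"
  shows "p_variation p f P < \<infinity> \<longleftrightarrow> (\<exists>W. variation_le p f P W)"
proof -
  define V where "V \<I> = (\<Sum>I\<in>\<I>. rosc f I powr p)" for \<I>
  have V0: "0 \<le> V \<I>" for \<I>
    by (simp add: V_def sum_nonneg)
  have "(\<Sum>I\<in>\<I>. ennreal_powr (osc f I) p) = ennreal (V \<I>)" for \<I>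
    by (simp add: V_def osc_eq_ennreal_rosc[OF assms(1)] ennreal_powr_def rosc_nonneg sum_ennreal)
  then have eq: "p_variation p f P = (SUP \<I>\<in>interval_families {0..P}. ennreal (V \<I> powr (1 / p)))"
    by (simp add: p_variation_def ennreal_powr_def V0)
  show ?thesis
  proof
    assume fin: "p_variation p f P < \<infinity>"
    define v where "v = enn2real (p_variation p f P)"
    have v: "p_variation p f P = ennreal v" "0 \<le> v"
      using fin by (simp_all add: v_def)
    have "V \<I> \<le> v powr p" if "\<I> \<in> interval_families {0..P}" for \<I>
    proof -
      have "ennreal (V \<I> powr (1 / p)) \<le> ennreal v"
        unfolding v(1)[symmetric] eq using that by (rule SUP_upper)
      then have "V \<I> powr (1 / p) \<le> v"
        using v(2) by simp
      then have "(V \<I> powr (1 / p)) powr p \<le> v powr p"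
        using assms(2) by (intro powr_mono2) auto
      then show ?thesis
        using assms(2) V0[of \<I>] by (simp add: powr_powr)
    qed
    then show "\<exists>W. variation_le p f P W"
      unfolding variation_le_def V_def by blast
  next
    assume "\<exists>W. variation_le p f P W"
    then obtain W where "V \<I> \<le> W" if "\<I> \<in> interval_families {0..P}" for \<I>
      unfolding variation_le_def V_def by blast
    then have "p_variation p f P \<le> ennreal (W powr (1 / p))"
      unfolding eq using assms(2) V0 by (intro SUP_least ennreal_leI powr_mono2) auto
    then show "p_variation p f P < \<infinity>"
      by (simp add: order.strict_trans1)
  qed
qed

lemma interval_families_subset:
  assumes "\<I> \<in> interval_families S" "\<J> \<subseteq> \<I>" "\<And>J. J \<in> \<J> \<Longrightarrow> J \<subseteq> T"
  shows "\<J> \<in> interval_families T"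
  using assms by (auto simp: interval_families_def intro: finite_subset pairwise_subset)

lemma affine_image_family:
  fixes c d :: real
  assumes "\<I> \<in> interval_families S" "c > 0" "\<And>x. x \<in> S \<Longrightarrow> c * x + d \<in> T"
  shows "(`) (\<lambda>x. c * x + d) ` \<I> \<in> interval_families T"
    and "(\<Sum>I\<in>(`) (\<lambda>x. c * x + d) ` \<I>. rosc f I powr p) =
         (\<Sum>I\<in>\<I>. rosc (\<lambda>x. f (c * x + d)) I powr p)"
proof -
  let ?h = "\<lambda>x. c * x + d"
  have inj: "inj ?h"
    using assms(2) by (auto intro: injI)
  have "is_interval (?h ` I)" if "is_interval I" for I
  proof -
    have "?h ` I = (\<lambda>x. d + c *\<^sub>R x) ` I"
      by (simp add: add.commute)
    then show ?thesis
      using that convex_affinity[of I d c] by (simp add: is_interval_convex_1)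
  qed
  moreover have "disjoint ((`) ?h ` \<I>)"
  proof (intro disjointI, clarify)
    fix I J assume "I \<in> \<I>" "J \<in> \<I>" "?h ` I \<noteq> ?h ` J"
    then have "I \<noteq> J"
      by blast
    with \<open>I \<in> \<I>\<close> \<open>J \<in> \<I>\<close> have "I \<inter> J = {}"
      using assms(1) by (auto simp: interval_families_def disjoint_def)
    then show "?h ` I \<inter> ?h ` J = {}"
      by (simp add: image_Int[OF inj, symmetric])
  qed
  ultimately show "(`) ?h ` \<I> \<in> interval_families T"
    using assms(1,3) unfolding interval_families_def by blast
  have "inj_on ((`) ?h) \<I>"
    using inj by (simp add: inj_on_def inj_image_eq_iff)
  then show "(\<Sum>I\<in>(`) ?h ` \<I>. rosc f I powr p) = (\<Sum>I\<in>\<I>. rosc (\<lambda>x. f (?h x)) I powr p)"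
    by (simp add: sum.reindex rosc_image)
qed

lemma variation_le_nonneg: "variation_le p f P W \<Longrightarrow> 0 \<le> W"
  unfolding variation_le_def
  by (drule bspec[of _ _ "{}"]) (simp_all add: interval_families_def)

lemma periodic_shift:
  fixes f :: "real \<Rightarrow> 'a"
  assumes "\<And>x. f (x + P) = f x"
  shows "f (x + of_nat n * P) = f x"
proof (induction n)
  case (Suc n)
  have "f (x + of_nat (Suc n) * P) = f ((x + of_nat n * P) + P)"
    by (simp add: algebra_simps)
  then show ?case
    using assms Suc by simp
qed simp

lemma rosc_periodic_le:
  assumes per: "\<And>x. f (x + P) = f x" and "P > 0" "bounded (range f)"
    and E: "E \<subseteq> {0..of_nat n * P}"
  shows "rosc f E \<le> rosc f {0..P}"
proof (rule rosc_le)
  have red: "\<exists>x'\<in>{0..P}. f x' = f x" if "x \<in> E" for x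
  proof -
    have x: "0 \<le> x" using that E by auto
    define k where "k = nat \<lfloor>x / P\<rfloor>"
    have "real k \<le> x / P" "x / P < real k + 1"
      using x \<open>P > 0\<close> by (auto simp: k_def)
    then have "real k * P \<le> x" "x < (real k + 1) * P"
      using \<open>P > 0\<close> by (auto simp: pos_le_divide_eq pos_divide_less_eq)
    then have "x - real k * P \<in> {0..P}"
      by (auto simp: algebra_simps)
    moreover have "f (x - real k * P) = f x"
      using periodic_shift[of f P "x - real k * P" k, OF per] by simp
    ultimately show ?thesis by blast
  qed
  fix x y assume "x \<in> E" "y \<in> E"
  then obtain x' y' where "x' \<in> {0..P}" "f x' = f x" "y' \<in> {0..P}" "f y' = f y"
    using red by meson
  then show "cmod (f x - f y) \<le> rosc f {0..P}"
    using le_rosc[OF assms(3), of x' "{0..P}" y'] by simp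
qed (rule rosc_nonneg)

text \<open>
  Cut \<open>[0, NP]\<close> at the multiples of \<open>P\<close>. The intervals of a family that lie between two
  consecutive cuts contribute at most \<open>W\<close> by translation. At most one interval contains a given cut,
  and a periodic function oscillates on it no more than on a full period. So each further period costs
  at most \<open>2W\<close>. Linear growth in \<open>N\<close> is what matters later: the function \<open>f(4\<^sup>kx)\<close> runs
  through \<open>4\<^sup>k\<close> periods.
\<close>

lemma variation_le_periods:
  assumes per: "\<And>x. f (x + P) = f x" and P: "P > 0" and bdd: "bounded (range f)"
    and W: "variation_le p f P W" and p: "p \<ge> 1"
  shows "variation_le p f (of_nat N * P) (2 * of_nat N * W)"
proof (induction N)
  case 0
  have "rosc f I powr p = 0" if "I \<subseteq> {0}" for I
  proof -
    have "rosc f I \<le> 0"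
      using that by (intro rosc_le) auto
    then show ?thesis
      using rosc_nonneg[of f I] by simp
  qed
  then show ?case
    by (auto simp: variation_le_def interval_families_def intro!: sum_nonpos)
next
  case (Suc N)
  show ?case
    unfolding variation_le_def
  proof
    fix \<I> assume I: "\<I> \<in> interval_families {0..of_nat (Suc N) * P}"
    define b where "b = real N * P"
    define A where "A = {I\<in>\<I>. I \<subseteq> {0..b}}"
    define B where "B = {I\<in>\<I>. I \<subseteq> {b..b + P}}"
    define C where "C = {I\<in>\<I>. b \<in> I}"
    have sub: "I \<subseteq> {0..b + P}" "is_interval I" if "I \<in> \<I>" for I
      using I that by (auto simp: interval_families_def b_def algebra_simps)
    have "finite \<I>"
      using I by (simp add: interval_families_def)
    then have fin: "finite A" "finite B" "finite C"
      by (simp_all add: A_def B_def C_def)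
    have cover: "\<I> \<subseteq> A \<union> B \<union> C"
    proof
      fix I assume "I \<in> \<I>"
      moreover have "I \<subseteq> {0..b} \<or> I \<subseteq> {b..b + P}" if "b \<notin> I"
      proof -
        have "\<not> (x \<le> b \<and> b \<le> y)" if "x \<in> I" "y \<in> I" for x y
          using mem_is_interval_1_I[OF sub(2)[OF \<open>I \<in> \<I>\<close>] that, of b] \<open>b \<notin> I\<close> by blast
        then have "(\<forall>x\<in>I. x \<le> b) \<or> (\<forall>x\<in>I. b \<le> x)"
          by (meson linear)
        then show ?thesis
          using sub(1)[OF \<open>I \<in> \<I>\<close>] by fastforce
      qed
      ultimately have "I \<subseteq> {0..b} \<or> I \<subseteq> {b..b + P} \<or> b \<in> I"
        by blast
      then show "I \<in> A \<union> B \<union> C"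
        using \<open>I \<in> \<I>\<close> by (auto simp: A_def B_def C_def)
    qed
    let ?s = "\<lambda>\<J>. \<Sum>I\<in>\<J>. rosc f I powr p"
    have "A \<in> interval_families {0..real N * P}"
      by (rule interval_families_subset[OF I]) (auto simp: A_def b_def)
    then have sA: "?s A \<le> 2 * real N * W"
      using Suc unfolding variation_le_def by blast
    have Bf: "B \<in> interval_families {b..b + P}"
      by (rule interval_families_subset[OF I]) (auto simp: B_def)
    have "f (1 * x + - b) = f x" for x
      using periodic_shift[of f P "x - b" N, OF per] by (simp add: b_def)
    then have "?s B = ?s ((`) (\<lambda>x. 1 * x + - b) ` B)"
      by (subst affine_image_family(2)[OF Bf, of 1 "- b" "{0..P}"]) auto
    also have "\<dots> \<le> W"
      using affine_image_family(1)[OF Bf, of 1 "- b" "{0..P}"] W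
      unfolding variation_le_def by auto
    finally have sB: "?s B \<le> W" .
    have one: "rosc f I powr p \<le> W" if "I \<in> \<I>" for I
    proof -
      have "rosc f I \<le> rosc f {0..P}"
        using I that by (intro rosc_periodic_le[OF per P bdd, of I "Suc N"])
          (auto simp: interval_families_def)
      then have "rosc f I powr p \<le> rosc f {0..P} powr p"
        using p by (intro powr_mono2) (auto simp: rosc_nonneg)
      moreover have "{{0..P}} \<in> interval_families {0..P}"
        by (simp add: interval_families_def is_interval_cc)
      then have "rosc f {0..P} powr p \<le> W"
        using W unfolding variation_le_def by force
      ultimately show ?thesis by linarith
    qed
    have sC: "?s C \<le> W"
    proof (cases "C = {}")
      case True
      then show ?thesis using variation_le_nonneg[OF W] by simp
    next
      case False
      then obtain I where IC: "I \<in> C" by blast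
      have "J = I" if "J \<in> C" for J
        using I IC that unfolding C_def interval_families_def disjoint_def by blast
      then have "C = {I}" using IC by blast
      moreover have "I \<in> \<I>" using IC by (simp add: C_def)
      ultimately show ?thesis using one by simp
    qed
    have "?s \<I> \<le> ?s (A \<union> B \<union> C)"
      by (intro sum_mono2 cover) (use fin in auto)
    also have "\<dots> \<le> ?s (A \<union> B) + ?s C"
      using fin by (subst sum.union_inter[symmetric]) (auto intro: sum_nonneg)
    also have "?s (A \<union> B) \<le> ?s A + ?s B"
      using fin by (subst sum.union_inter[symmetric]) (auto intro: sum_nonneg)
    finally show "?s \<I> \<le> 2 * real (Suc N) * W"
      using sA sB sC by (simp add: algebra_simps)
  qed
qed

text \<open>
  Two-point convexity of \<open>x powr p\<close>. It stands in for Minkowski's inequality: the constant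
  \<open>2 powr (p - 1)\<close> that is lost is absorbed by the factors \<open>1/4\<close> of the recursion below.
\<close>

lemma powr_add_le:
  fixes a b p :: real
  assumes "0 \<le> a" "0 \<le> b" "1 \<le> p"
  shows "(a + b) powr p \<le> 2 powr (p - 1) * (a powr p + b powr p)"
proof (cases "a = 0 \<or> b = 0")
  case True
  have "1 \<le> 2 powr (p - 1)"
    using assms by (simp add: ge_one_powr_ge_zero)
  then have "1 * (a powr p + b powr p) \<le> 2 powr (p - 1) * (a powr p + b powr p)"
    by (intro mult_right_mono) auto
  then show ?thesis
    using True by auto
next
  case False
  then have "((1 - 1 / 2) *\<^sub>R a + (1 / 2) *\<^sub>R b) powr p \<le> (1 - 1 / 2) * a powr p + (1 / 2) * b powr p"
    using assms by (intro convex_onD[OF powr_convex]) auto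
  then have "((a + b) / 2) powr p \<le> (a powr p + b powr p) / 2"
    by (simp add: add_divide_distrib)
  moreover have "((a + b) / 2) powr p = (a + b) powr p / 2 powr p"
    using assms by (simp add: powr_divide)
  ultimately have "(a + b) powr p \<le> 2 powr p * ((a powr p + b powr p) / 2)"
    by (simp add: divide_le_eq mult.commute)
  then show ?thesis
    by (simp add: powr_diff)
qed

section \<open>The cosine series and its quarter-phase recursion\<close>

definition riemann_C :: "real \<Rightarrow> real" where
  "riemann_C x = (\<Sum>n. cos (pi * real (Suc n) ^ 2 * x) / real (Suc n) ^ 2)"

lemma summable_inverse_squares: "summable (\<lambda>n. 1 / real (Suc n) ^ 2)"
  using inverse_power_summable[of 2, where 'a = real]
  by (subst summable_Suc_iff) (simp add: inverse_eq_divide)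

lemma summable_riemann_C: "summable (\<lambda>n. cos (pi * real (Suc n) ^ 2 * x) / real (Suc n) ^ 2)"
  by (rule summable_comparison_test'[OF summable_inverse_squares])
    (simp add: divide_right_mono del: of_nat_Suc)

lemma bounded_riemann_R: "bounded (range (\<lambda>x. complex_of_real (riemann_R x)))"
proof -
  have "\<bar>riemann_R x\<bar> \<le> (\<Sum>n. 1 / real (Suc n) ^ 2)" for x
    unfolding riemann_R_def real_norm_def[symmetric]
    by (rule norm_suminf_le[OF _ summable_inverse_squares])
      (simp add: divide_right_mono del: of_nat_Suc)
  then show ?thesis
    by (auto simp: bounded_iff)
qed

lemma bounded_riemann_C: "bounded (range (\<lambda>x. complex_of_real (riemann_C x)))"
proof -
  have "\<bar>riemann_C x\<bar> \<le> (\<Sum>n. 1 / real (Suc n) ^ 2)" for x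
    unfolding riemann_C_def real_norm_def[symmetric]
    by (rule norm_suminf_le[OF _ summable_inverse_squares])
      (simp add: divide_right_mono del: of_nat_Suc)
  then show ?thesis
    by (auto simp: bounded_iff)
qed

lemma riemann_Phi_eq:
  "riemann_Phi x = (complex_of_real (riemann_R x) - \<i> * complex_of_real (riemann_C x)) / of_real pi"
proof -
  let ?s = "\<lambda>n. sin (pi * real (Suc n) ^ 2 * x) / real (Suc n) ^ 2"
  let ?c = "\<lambda>n. cos (pi * real (Suc n) ^ 2 * x) / real (Suc n) ^ 2"
  have "(\<lambda>n. (complex_of_real (?s n) - \<i> * complex_of_real (?c n)) / of_real pi) sums
        ((complex_of_real (riemann_R x) - \<i> * complex_of_real (riemann_C x)) / of_real pi)"
    unfolding riemann_R_def riemann_C_def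
    by (intro sums_divide sums_diff sums_mult sums_of_real summable_sums
        summable_riemann_R summable_riemann_C)
  moreover have "(complex_of_real (?s n) - \<i> * complex_of_real (?c n)) / of_real pi =
      exp (of_real pi * \<i> * of_nat (Suc n) ^ 2 * of_real x) / (of_real pi * \<i> * of_nat (Suc n) ^ 2)" for n
  proof -
    define t where "t = pi * real (Suc n) ^ 2 * x"
    have "exp (of_real pi * \<i> * of_nat (Suc n) ^ 2 * of_real x) = exp (\<i> * complex_of_real t)"
      by (simp add: t_def mult_ac del: of_nat_Suc)
    also have "\<dots> = complex_of_real (cos t) + \<i> * complex_of_real (sin t)"
      by (metis exp_Euler cos_of_real sin_of_real)
    finally have e: "exp (of_real pi * \<i> * of_nat (Suc n) ^ 2 * of_real x)
        = complex_of_real (cos t) + \<i> * complex_of_real (sin t)" .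
    show ?thesis
      unfolding e t_def[symmetric] by (simp add: field_simps del: of_nat_Suc)
  qed
  ultimately show ?thesis
    unfolding riemann_Phi_def by (metis (no_types, lifting) sums_cong sums_unique)
qed

lemma bounded_riemann_Phi: "bounded (range riemann_Phi)"
proof -
  obtain A B where A: "\<bar>riemann_R x\<bar> \<le> A" and B: "\<bar>riemann_C x\<bar> \<le> B" for x
    using bounded_riemann_R bounded_riemann_C by (auto simp: bounded_iff)
  have "cmod (riemann_Phi x) \<le> (A + B) / pi" for x
  proof -
    have "cmod (complex_of_real (riemann_R x) - \<i> * complex_of_real (riemann_C x))
        \<le> \<bar>riemann_R x\<bar> + \<bar>riemann_C x\<bar>"
      by (rule order_trans[OF norm_triangle_ineq4]) (simp add: norm_mult)
    also have "\<dots> \<le> A + B"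
      using A[of x] B[of x] by linarith
    finally show ?thesis
      by (simp add: riemann_Phi_eq norm_divide divide_right_mono)
  qed
  then show ?thesis
    by (auto simp: bounded_iff)
qed

lemma sin_add_of_int_2pi: "sin (t + of_int m * (2 * pi)) = sin t"
  using sin.plus_of_int[of t m] by simp

lemma cos_add_of_int_2pi: "cos (t + of_int m * (2 * pi)) = cos t"
  using cos.plus_of_int[of t m] by simp

text \<open>
  Shifting \<open>x\<close> by \<open>1/2\<close> adds \<open>\<pi>n\<^sup>2/2\<close> to the phase of the \<open>n\<close>-th term of the sine series.
  For odd \<open>n\<close> this is \<open>\<pi>/2\<close> modulo \<open>2\<pi>\<close>, because odd squares are \<open>1\<close> modulo \<open>4\<close>,
  and the sine becomes a cosine. For even \<open>n\<close> it is a multiple of \<open>2\<pi>\<close>, so the term does not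
  change; since \<open>(2m)\<^sup>2 = 4m\<^sup>2\<close>, the even terms of either series reproduce a quarter of that series
  at \<open>4x\<close>.
\<close>

lemma riemann_C_quarter_shift:
  "riemann_C x = riemann_R (x + 1 / 2) - riemann_R (4 * x) / 4 + riemann_C (4 * x) / 4"
proof -
  define d where "d n = (cos (pi * real (Suc n) ^ 2 * x) - sin (pi * real (Suc n) ^ 2 * (x + 1 / 2)))
      / real (Suc n) ^ 2" for n
  define g where "g m = 2 * m + 1" for m :: nat
  have d_sums: "d sums (riemann_C x - riemann_R (x + 1 / 2))"
    unfolding d_def diff_divide_distrib riemann_R_def riemann_C_def
    by (intro sums_diff summable_sums summable_riemann_R summable_riemann_C)
  have d_odd: "d n = 0" if "n \<notin> range g" for n
  proof -
    have "even n"
      using that unfolding g_def by (metis oddE rangeI)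
    then obtain k where n: "n = 2 * k" by blast
    have "pi * real (Suc n) ^ 2 * (x + 1 / 2)
        = pi * real (Suc n) ^ 2 * x + pi / 2 + of_int (int (k * (k + 1))) * (2 * pi)"
      by (simp add: n power2_eq_square algebra_simps)
    then have "sin (pi * real (Suc n) ^ 2 * (x + 1 / 2)) = sin (pi * real (Suc n) ^ 2 * x + pi / 2)"
      by (simp only: sin_add_of_int_2pi)
    then show ?thesis
      by (simp add: d_def sin_add)
  qed
  have d_even: "d (g m) = (cos (pi * real (Suc m) ^ 2 * (4 * x)) / real (Suc m) ^ 2
      - sin (pi * real (Suc m) ^ 2 * (4 * x)) / real (Suc m) ^ 2) / 4" for m
  proof -
    have s: "real (Suc (g m)) = 2 * real (Suc m)"
      by (simp add: g_def)
    have "pi * real (Suc (g m)) ^ 2 * (x + 1 / 2)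
        = pi * real (Suc m) ^ 2 * (4 * x) + of_int (int (Suc m) ^ 2) * (2 * pi)"
      unfolding s by (simp add: power2_eq_square algebra_simps del: of_nat_Suc)
    then have "sin (pi * real (Suc (g m)) ^ 2 * (x + 1 / 2)) = sin (pi * real (Suc m) ^ 2 * (4 * x))"
      by (simp only: sin_add_of_int_2pi)
    moreover have "pi * real (Suc (g m)) ^ 2 * x = pi * real (Suc m) ^ 2 * (4 * x)"
      unfolding s by (simp add: power_mult_distrib del: of_nat_Suc)
    moreover have "real (Suc (g m)) ^ 2 = real (Suc m) ^ 2 * 4"
      unfolding s by (simp add: power_mult_distrib del: of_nat_Suc)
    ultimately show ?thesis
      by (simp only: d_def) (simp add: diff_divide_distrib del: of_nat_Suc)
  qed
  have "(\<lambda>m. d (g m)) sums ((riemann_C (4 * x) - riemann_R (4 * x)) / 4)"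
    unfolding d_even riemann_R_def riemann_C_def
    by (intro sums_divide sums_diff summable_sums summable_riemann_R summable_riemann_C)
  moreover have "(\<lambda>m. d (g m)) sums (riemann_C x - riemann_R (x + 1 / 2))"
    using d_sums sums_mono_reindex[of g d] d_odd by (auto simp: g_def strict_mono_def)
  ultimately show ?thesis
    using sums_unique2 by fastforce
qed

lemma sum_rosc_scaled_le:
  assumes per: "\<And>x. f (x + 2) = f x" and bdd: "bounded (range f)"
    and W: "variation_le p f 2 W" and p: "p \<ge> 1"
    and I: "\<I> \<in> interval_families {0..2}" and c: "c > 0" "0 \<le> d" "2 * c + d \<le> 2 * real N"
  shows "(\<Sum>I\<in>\<I>. rosc (\<lambda>x. f (c * x + d)) I powr p) \<le> 2 * real N * W"
proof -
  have into: "c * x + d \<in> {0..real N * 2}" if "x \<in> {0..2}" for x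
  proof -
    have "c * x \<le> c * 2"
      using that c(1) by (intro mult_left_mono) auto
    moreover have "0 \<le> c * x"
      using that c(1) by simp
    ultimately show ?thesis
      using c(2,3) by auto
  qed
  have "variation_le p f (real N * 2) (2 * real N * W)"
    by (rule variation_le_periods[OF per _ bdd W p]) auto
  then show ?thesis
    using affine_image_family[OF I c(1) into] unfolding variation_le_def by metis
qed

text \<open>
  Let \<open>T k\<close> be the sum of the \<open>p\<close>-th powers of the oscillations of \<open>C(4\<^sup>kx)\<close> over a fixed family.
  The recursion for \<open>C\<close> gives \<open>T k \<le> A 4\<^sup>k + s T (k + 1)\<close>: the sine terms run through about
  \<open>4\<^sup>k\<close> periods, and \<open>s = 2 powr (p - 1) / 4 powr p = 2 powr (- 1 - p)\<close>. Iterating,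
  \<open>T 0\<close> is at most a geometric series with ratio \<open>4s = 2 powr (1 - p)\<close>, which is less than \<open>1\<close>
  exactly when \<open>p > 1\<close>, plus a remainder \<open>s\<^sup>K T K\<close>. The remainder vanishes in the limit because
  \<open>C\<close> is bounded and the family is finite; the resulting bound no longer depends on the family.
\<close>

lemma variation_riemann_C:
  assumes p: "p > 1" and W: "variation_le p (\<lambda>x. complex_of_real (riemann_R x)) 2 W"
  shows "\<exists>V. variation_le p (\<lambda>x. complex_of_real (riemann_C x)) 2 V"
proof -
  let ?R = "\<lambda>x. complex_of_real (riemann_R x)"
  let ?C = "\<lambda>x. complex_of_real (riemann_C x)"
  define s where "s = 2 powr (- 1 - p)"
  \<comment> \<open>The two sine terms run through at most \<open>4\<^sup>k + 1\<close> and \<open>4 \<cdot> 4\<^sup>k\<close> periods, at a cost of \<open>2W\<close> each;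
      \<open>12 \<cdot> 4\<^sup>k\<close> bounds \<open>2 (4\<^sup>k + 1) + 8 \<cdot> 4\<^sup>k\<close>.\<close>
  define A where "A = 2 powr (p - 1) * (2 powr (p - 1) * (12 * W))"
  have s: "0 < s" "4 * s < 1"
  proof -
    have "4 * s = 2 powr 2 * 2 powr (- 1 - p)"
      by (simp add: s_def)
    also have "\<dots> = 2 powr (1 - p)"
      by (simp only: powr_add[symmetric]) simp
    also have "\<dots> < 2 powr 0"
      using p by (intro powr_less_mono) auto
    finally show "4 * s < 1" by simp
  qed (simp add: s_def)
  have W0: "0 \<le> W"
    using W by (rule variation_le_nonneg)
  have A0: "0 \<le> A"
    using W0 by (simp add: A_def)
  obtain M where M: "\<bar>riemann_C x\<bar> \<le> M" for x
    using bounded_riemann_C by (auto simp: bounded_iff)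
  have "(\<Sum>I\<in>\<I>. rosc ?C I powr p) \<le> A / (1 - 4 * s)" if I: "\<I> \<in> interval_families {0..2}" for \<I>
  proof -
    define T where "T k = (\<Sum>I\<in>\<I>. rosc (\<lambda>x. ?C (4 ^ k * x)) I powr p)" for k :: nat
    have step: "T k \<le> A * 4 ^ k + s * T (Suc k)" for k
    proof -
      define a where "a I = rosc (\<lambda>x. ?R (4 ^ k * x + 1 / 2)) I" for I
      define b where "b I = rosc (\<lambda>x. ?R (4 ^ Suc k * x + 0)) I" for I
      define c where "c I = rosc (\<lambda>x. ?C (4 ^ Suc k * x)) I" for I
      define e where "e x = ?R (4 ^ k * x + 1 / 2) - ?R (4 ^ Suc k * x + 0) / 4" for x
      have bR: "bounded (range (\<lambda>x. ?R (h x)))" for h :: "real \<Rightarrow> real"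
        by (rule bounded_subset[OF bounded_riemann_R]) auto
      have bC: "bounded (range (\<lambda>x. ?C (h x)))" for h :: "real \<Rightarrow> real"
        by (rule bounded_subset[OF bounded_riemann_C]) auto
      have be: "bounded (range e)"
        unfolding e_def using bounded_minus_comp[OF bR bounded_scaleR_comp[OF bR, of "1/4"]]
        by (simp add: scaleR_conv_of_real)
      have "rosc e I \<le> cmod 1 * a I + cmod (- 1 / 4) * b I" for I
        unfolding a_def b_def by (rule rosc_linear_combination_le[OF bR bR]) (simp add: e_def)
      then have e_le: "rosc e I \<le> a I + b I / 4" for I
        by simp
      have C_eq: "?C (4 ^ k * x) = 1 * e x + 1 / 4 * ?C (4 ^ Suc k * x)" for x
      proof -
        have "?C (4 ^ k * x) = complex_of_real (riemann_R (4 ^ k * x + 1 / 2)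
            - riemann_R (4 * (4 ^ k * x)) / 4 + riemann_C (4 * (4 ^ k * x)) / 4)"
          by (simp only: riemann_C_quarter_shift[of "4 ^ k * x"])
        then show ?thesis
          by (simp add: e_def mult.assoc)
      qed
      have "rosc (\<lambda>x. ?C (4 ^ k * x)) I \<le> cmod 1 * rosc e I + cmod (1 / 4) * c I" for I
        unfolding c_def by (rule rosc_linear_combination_le[OF be bC C_eq])
      then have C_le: "rosc (\<lambda>x. ?C (4 ^ k * x)) I \<le> rosc e I + c I / 4" for I
        by simp
      have nn: "0 \<le> a I" "0 \<le> b I" "0 \<le> c I" for I
        by (auto simp: a_def b_def c_def rosc_nonneg)
      have "T k \<le> (\<Sum>I\<in>\<I>. 2 powr (p - 1) * (2 powr (p - 1) * (a I powr p + b I powr p)) + s * c I powr p)"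
        unfolding T_def
      proof (rule sum_mono)
        fix I
        have "rosc (\<lambda>x. ?C (4 ^ k * x)) I \<le> (a I + b I) + c I / 4"
          using C_le[of I] e_le[of I] nn[of I] by linarith
        then have "rosc (\<lambda>x. ?C (4 ^ k * x)) I powr p \<le> ((a I + b I) + c I / 4) powr p"
          using p by (intro powr_mono2) (auto simp: rosc_nonneg)
        also have "\<dots> \<le> 2 powr (p - 1) * ((a I + b I) powr p + (c I / 4) powr p)"
          using p nn[of I] by (intro powr_add_le) auto
        also have "\<dots> \<le> 2 powr (p - 1) * (2 powr (p - 1) * (a I powr p + b I powr p) + (c I / 4) powr p)"
          using p nn[of I] by (intro mult_left_mono add_right_mono powr_add_le) auto
        also have "2 powr (p - 1) * (c I / 4) powr p = s * c I powr p"
        proof -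
          have "4 powr p = 2 powr (2 * p)"
            by (simp add: powr_powr[symmetric])
          then have "2 powr (p - 1) / 4 powr p = s"
            by (simp only: s_def powr_diff[symmetric]) (simp add: algebra_simps)
          then show ?thesis
            using nn[of I] by (simp add: powr_divide field_simps)
        qed
        then have "2 powr (p - 1) * (2 powr (p - 1) * (a I powr p + b I powr p) + (c I / 4) powr p)
            = 2 powr (p - 1) * (2 powr (p - 1) * (a I powr p + b I powr p)) + s * c I powr p"
          by (simp add: distrib_left)
        finally show "rosc (\<lambda>x. ?C (4 ^ k * x)) I powr p
            \<le> 2 powr (p - 1) * (2 powr (p - 1) * (a I powr p + b I powr p)) + s * c I powr p" .
      qed
      also have "\<dots> = 2 powr (p - 1) * (2 powr (p - 1) * ((\<Sum>I\<in>\<I>. a I powr p) + (\<Sum>I\<in>\<I>. b I powr p))) + s * T (Suc k)"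
        by (simp only: sum.distrib sum_distrib_left[symmetric] T_def c_def)
      also have "\<dots> \<le> A * 4 ^ k + s * T (Suc k)"
      proof -
        have "(\<Sum>I\<in>\<I>. a I powr p) \<le> 2 * real (4 ^ k + 1) * W"
          unfolding a_def using p
          by (intro sum_rosc_scaled_le[OF _ bounded_riemann_R W _ I]) (auto simp: riemann_R_periodic)
        moreover have "(\<Sum>I\<in>\<I>. b I powr p) \<le> 2 * real (4 ^ Suc k) * W"
          unfolding b_def using p
          by (intro sum_rosc_scaled_le[OF _ bounded_riemann_R W _ I]) (auto simp: riemann_R_periodic)
        moreover have "2 * real (4 ^ k + 1) * W + 2 * real (4 ^ Suc k) * W \<le> 12 * 4 ^ k * W"
        proof -
          have "1 * W \<le> 4 ^ k * W"
            using W0 by (intro mult_right_mono) auto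
          then show ?thesis
            by (simp add: algebra_simps)
        qed
        ultimately have "(\<Sum>I\<in>\<I>. a I powr p) + (\<Sum>I\<in>\<I>. b I powr p) \<le> 12 * W * 4 ^ k"
          by (simp add: mult_ac)
        then have "2 powr (p - 1) * (2 powr (p - 1) * ((\<Sum>I\<in>\<I>. a I powr p) + (\<Sum>I\<in>\<I>. b I powr p)))
            \<le> 2 powr (p - 1) * (2 powr (p - 1) * (12 * W * 4 ^ k))"
          by (intro mult_left_mono) auto
        then show ?thesis
          by (simp add: A_def mult_ac)
      qed
      finally show ?thesis .
    qed
    have iter: "T 0 \<le> A * (\<Sum>k<K. (4 * s) ^ k) + s ^ K * T K" for K
    proof (induction K)
      case (Suc K)
      have "s ^ K * T K \<le> s ^ K * (A * 4 ^ K + s * T (Suc K))"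
        using step s(1) by (intro mult_left_mono) auto
      also have "\<dots> = A * (4 * s) ^ K + s ^ Suc K * T (Suc K)"
        by (simp add: algebra_simps power_mult_distrib)
      finally show ?case
        using Suc by (simp add: distrib_left)
    qed simp
    define D where "D = real (card \<I>) * (2 * M) powr p"
    have T_le: "T k \<le> D" for k
    proof -
      have "rosc (\<lambda>x. ?C (4 ^ k * x)) I powr p \<le> (2 * M) powr p" for I
      proof (intro powr_mono2 rosc_le)
        fix x y
        show "cmod (?C (4 ^ k * x) - ?C (4 ^ k * y)) \<le> 2 * M"
          using M[of "4 ^ k * x"] M[of "4 ^ k * y"] by (simp flip: of_real_diff)
        show "0 \<le> 2 * M"
          using M[of 0] by linarith
      qed (use p in \<open>auto simp: rosc_nonneg\<close>)
      then show ?thesis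
        unfolding T_def D_def by (intro sum_bounded_above) auto
    qed
    have bound: "T 0 \<le> A / (1 - 4 * s) + s ^ K * D" for K
    proof -
      have "(\<Sum>k<K. (4 * s) ^ k) \<le> (\<Sum>k. (4 * s) ^ k)"
        using s by (intro sum_le_suminf summable_geometric) auto
      also have "\<dots> = 1 / (1 - 4 * s)"
        using s by (intro suminf_geometric) auto
      finally have "A * (\<Sum>k<K. (4 * s) ^ k) \<le> A * (1 / (1 - 4 * s))"
        using A0 by (rule mult_left_mono)
      moreover have "s ^ K * T K \<le> s ^ K * D"
        using T_le s by (intro mult_left_mono) auto
      ultimately show ?thesis
        using iter[of K] by simp
    qed
    have "(\<lambda>K. A / (1 - 4 * s) + s ^ K * D) \<longlonglongrightarrow> A / (1 - 4 * s) + 0 * D"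
      using s by (intro tendsto_intros LIMSEQ_power_zero) auto
    then have "T 0 \<le> A / (1 - 4 * s) + 0 * D"
      using bound by (intro LIMSEQ_le_const) auto
    then show ?thesis
      by (simp add: T_def)
  qed
  then show ?thesis
    unfolding variation_le_def by blast
qed

section \<open>Riesz products with lacunary square frequencies\<close>

text \<open>
  \<open>lac_deg k\<close> is the degree (largest frequency) of the Riesz product with the first \<open>k\<close> factors,
  and the next frequency is the square of \<open>n = lac_deg k + 1\<close>. Any other positive square differs
  from \<open>n\<^sup>2\<close> by more than \<open>n\<close>, hence by more than the degree. So adding the new frequency to the spectrum of the previous product creates
  no square other than the new frequency itself.
\<close>

fun lac_deg :: "nat \<Rightarrow> nat" where
  "lac_deg 0 = 0"
| "lac_deg (Suc k) = lac_deg k + (lac_deg k + 1) ^ 2"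

definition lac_root :: "nat \<Rightarrow> nat" where
  "lac_root k = lac_deg k + 1"

lemma strict_mono_lac_root: "strict_mono lac_root"
  by (rule strict_monoI_Suc) (simp add: lac_root_def)

text \<open>
  The imaginary unit makes the factors grow only to second order in \<open>a\<close>: with \<open>a = 1/\<surd>K\<close> the
  product of \<open>K\<close> factors stays bounded, while its \<open>K\<close> first-order coefficients add up to
  order \<open>\<surd>K\<close>.
\<close>

fun riesz :: "real \<Rightarrow> nat \<Rightarrow> real \<Rightarrow> complex" where
  "riesz a 0 x = 1"
| "riesz a (Suc k) x = riesz a k x * (1 + \<i> * of_real (a * cos (pi * real (lac_root k) ^ 2 * x)))"

lemma continuous_on_riesz: "continuous_on S (riesz a k)"
  by (induction k) (auto intro!: continuous_intros)

lemma norm_riesz_le: "cmod (riesz a k x) ^ 2 \<le> (1 + a ^ 2) ^ k"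
proof (induction k)
  case (Suc k)
  define c where "c = cos (pi * real (lac_root k) ^ 2 * x)"
  have "cmod (1 + \<i> * of_real (a * c)) ^ 2 = 1 + (a * c) ^ 2"
    by (simp add: cmod_power2)
  also have "\<dots> \<le> 1 + a ^ 2"
    by (simp add: c_def power_mult_distrib mult_left_le abs_square_le_1)
  finally have "cmod (riesz a k x) ^ 2 * cmod (1 + \<i> * of_real (a * c)) ^ 2
      \<le> (1 + a ^ 2) ^ k * (1 + a ^ 2)"
    using Suc by (intro mult_mono) auto
  then show ?case
    by (simp add: c_def norm_mult power_mult_distrib mult.commute)
qed simp

text \<open>
  The phase \<open>\<theta>\<close> lets one quantity carry both the sine and the cosine coefficient; shifting the
  argument of the sine series by \<open>h\<close> only changes \<open>\<theta>\<close>.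
\<close>

definition riesz_coeff :: "real \<Rightarrow> nat \<Rightarrow> int \<Rightarrow> real \<Rightarrow> complex" where
  "riesz_coeff a k m \<theta> =
     integral {0..2} (\<lambda>x. of_real (sin (pi * of_int m * x + \<theta>)) * riesz a k x)"

lemma riesz_coeff_integrable:
  "(\<lambda>x. of_real (sin (pi * of_int m * x + \<theta>)) * riesz a k x) integrable_on {0..2}"
  by (intro integrable_continuous_interval continuous_intros continuous_on_riesz)

lemma riesz_coeff_0: "riesz_coeff a 0 m \<theta> = (if m = 0 then of_real (2 * sin \<theta>) else 0)"
proof (cases "m = 0")
  case False
  define F where "F x = - cos (pi * of_int m * x + \<theta>) / (pi * of_int m)" for x
  have "((\<lambda>x. sin (pi * of_int m * x + \<theta>)) has_integral (F 2 - F 0)) {0..2}"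
  proof (rule fundamental_theorem_of_calculus)
    fix x :: real
    have "(F has_real_derivative sin (pi * of_int m * x + \<theta>)) (at x within {0..2})"
      unfolding F_def using False by (auto intro!: derivative_eq_intros)
    then show "(F has_vector_derivative sin (pi * of_int m * x + \<theta>)) (at x within {0..2})"
      by (simp add: has_real_derivative_iff_has_vector_derivative)
  qed simp
  moreover have "pi * of_int m * 2 + \<theta> = \<theta> + of_int m * (2 * pi)"
    by simp
  then have "cos (pi * of_int m * 2 + \<theta>) = cos \<theta>"
    by (simp only: cos_add_of_int_2pi)
  then have "F 2 - F 0 = 0"
    by (simp add: F_def)
  ultimately have "((\<lambda>x. complex_of_real (sin (pi * of_int m * x + \<theta>))) has_integral of_real 0) {0..2}"
    by (intro has_integral_of_real) simp
  then show ?thesis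
    using False by (simp add: riesz_coeff_def integral_unique)
qed (simp add: riesz_coeff_def scaleR_conv_of_real)

lemma riesz_coeff_Suc:
  "riesz_coeff a (Suc k) m \<theta> = riesz_coeff a k m \<theta> + \<i> * of_real a / 2 *
     (riesz_coeff a k (m + int (lac_root k) ^ 2) \<theta> + riesz_coeff a k (m - int (lac_root k) ^ 2) \<theta>)"
proof -
  define l where "l = int (lac_root k) ^ 2"
  let ?f = "\<lambda>m x. complex_of_real (sin (pi * of_int m * x + \<theta>)) * riesz a k x"
  have "complex_of_real (sin (pi * of_int m * x + \<theta>)) * riesz a (Suc k) x
      = ?f m x + \<i> * of_real a / 2 * (?f (m + l) x + ?f (m - l) x)" for x
  proof -
    have "of_int l = real (lac_root k) ^ 2"
      by (simp add: l_def)
    then have riesz: "riesz a (Suc k) x = riesz a k x * (1 + \<i> * of_real (a * cos (pi * of_int l * x)))"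
      by simp
    have "sin (pi * of_int (m + l) * x + \<theta>) + sin (pi * of_int (m - l) * x + \<theta>)
        = 2 * (sin (pi * of_int m * x + \<theta>) * cos (pi * of_int l * x))"
      using sin_times_cos[of "pi * of_int m * x + \<theta>" "pi * of_int l * x"]
      by (simp add: algebra_simps)
    then have "complex_of_real (sin (pi * of_int (m + l) * x + \<theta>)) + of_real (sin (pi * of_int (m - l) * x + \<theta>))
        = of_real (2 * (sin (pi * of_int m * x + \<theta>) * cos (pi * of_int l * x)))"
      by (simp only: of_real_add[symmetric])
    then have "\<i> * of_real a / 2 * (?f (m + l) x + ?f (m - l) x)
        = \<i> * of_real a / 2 * (of_real (2 * (sin (pi * of_int m * x + \<theta>) * cos (pi * of_int l * x))) * riesz a k x)"
      by (simp only: distrib_right[symmetric])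
    then show ?thesis
      unfolding riesz by (simp add: distrib_left mult_ac)
  qed
  then have "riesz_coeff a (Suc k) m \<theta>
      = integral {0..2} (\<lambda>x. ?f m x + \<i> * of_real a / 2 * (?f (m + l) x + ?f (m - l) x))"
    by (simp only: riesz_coeff_def)
  also have "\<dots> = riesz_coeff a k m \<theta> + \<i> * of_real a / 2 *
      (riesz_coeff a k (m + l) \<theta> + riesz_coeff a k (m - l) \<theta>)"
    unfolding riesz_coeff_def
    by (simp only: integral_add integral_mult_right riesz_coeff_integrable
        integrable_on_mult_right integrable_add)
  finally show ?thesis
    by (simp add: l_def)
qed

lemma riesz_coeff_eq_0:
  "int (lac_deg k) < \<bar>m\<bar> \<Longrightarrow> riesz_coeff a k m \<theta> = 0"
proof (induction k arbitrary: m)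
  case 0
  then show ?case by (simp add: riesz_coeff_0)
next
  case (Suc k)
  define l where "l = int (lac_root k) ^ 2"
  have "int (lac_deg (Suc k)) = int (lac_deg k) + l" "0 \<le> l"
    by (simp_all add: l_def lac_root_def)
  then have "int (lac_deg k) < \<bar>m\<bar>" "int (lac_deg k) < \<bar>m + l\<bar>" "int (lac_deg k) < \<bar>m - l\<bar>"
    using Suc.prems by linarith+
  then show ?case
    using Suc.IH by (simp add: riesz_coeff_Suc l_def)
qed

lemma lac_deg_less: "lac_deg k < lac_root k ^ 2"
  by (simp add: lac_root_def power2_eq_square)

lemma riesz_coeff_at_0: "riesz_coeff a k 0 \<theta> = of_real (2 * sin \<theta>)"
proof (induction k)
  case (Suc k)
  have "int (lac_deg k) < int (lac_root k) ^ 2"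
    using lac_deg_less[of k] by (metis of_nat_less_iff of_nat_power)
  then show ?case
    using Suc by (simp add: riesz_coeff_Suc riesz_coeff_eq_0)
qed (simp add: riesz_coeff_0)

text \<open>
  By induction on the number of factors. The new factor with frequency \<open>l\<close> contributes the
  coefficients at \<open>n\<^sup>2 \<plusminus> l\<close> of the previous product. Both vanish for degree reasons, except that
  \<open>n\<^sup>2 - l = 0\<close> when \<open>n\<^sup>2\<close> is the new frequency.
\<close>

lemma riesz_coeff_square:
  assumes "n \<ge> 1"
  shows "riesz_coeff a k (int n ^ 2) \<theta> =
    (if n \<in> lac_root ` {..<k} then \<i> * of_real (a * sin \<theta>) else 0)"
proof (induction k)
  case 0
  then show ?case using assms by (simp add: riesz_coeff_0)
next
  case (Suc k)
  define l where "l = int (lac_root k) ^ 2"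
  have l: "int (lac_deg k) < l"
    using lac_deg_less[of k] unfolding l_def by (metis of_nat_less_iff of_nat_power)
  then have "int (lac_deg k) < \<bar>int n ^ 2 + l\<bar>"
    using zero_le_power2[of "int n"] by linarith
  then have plus: "riesz_coeff a k (int n ^ 2 + l) \<theta> = 0"
    by (rule riesz_coeff_eq_0)
  show ?case
  proof (cases "n = lac_root k")
    case True
    then have "riesz_coeff a k (int n ^ 2) \<theta> = 0"
      using l by (intro riesz_coeff_eq_0) (simp add: l_def)
    then show ?thesis
      using plus True by (simp add: riesz_coeff_Suc riesz_coeff_at_0 l_def)
  next
    case False
    have "int (lac_deg k) < \<bar>int n ^ 2 - l\<bar>"
    proof -
      have "\<bar>int n ^ 2 - l\<bar> = \<bar>int n - int (lac_root k)\<bar> * (int n + int (lac_root k))"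
        by (simp add: l_def power2_eq_square square_diff_square_factored abs_mult)
      moreover have "int (lac_deg k) < 1 * (int n + int (lac_root k))"
        by (simp add: lac_root_def)
      moreover have "1 * (int n + int (lac_root k)) \<le> \<bar>int n - int (lac_root k)\<bar> * (int n + int (lac_root k))"
        using False by (intro mult_right_mono) auto
      ultimately show ?thesis
        by (simp only: order_less_le_trans)
    qed
    then have "riesz_coeff a k (int n ^ 2 - l) \<theta> = 0"
      by (rule riesz_coeff_eq_0)
    then show ?thesis
      using plus False Suc by (simp add: riesz_coeff_Suc l_def lessThan_Suc)
  qed
qed

lemma uniform_limit_riemann_R:
  "uniform_limit UNIV (\<lambda>N x. \<Sum>n<N. sin (pi * real (Suc n) ^ 2 * x) / real (Suc n) ^ 2) riemann_R sequentially"
  unfolding riemann_R_def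
  by (rule Weierstrass_m_test[OF _ summable_inverse_squares])
    (simp add: divide_right_mono del: of_nat_Suc)

lemma continuous_riemann_R: "continuous_on S riemann_R"
proof -
  have "continuous_on UNIV riemann_R"
    by (rule uniform_limit_theorem[OF _ uniform_limit_riemann_R])
      (auto intro!: always_eventually continuous_intros)
  then show ?thesis
    using continuous_on_subset by blast
qed

lemma continuous_riemann_R_difference: "continuous_on S (\<lambda>x. riemann_R (x + h) - riemann_R x)"
proof (intro continuous_on_diff continuous_riemann_R)
  have "continuous_on S (\<lambda>x. x + h)"
    by (intro continuous_intros)
  then show "continuous_on S (\<lambda>x. riemann_R (x + h))"
    by (rule continuous_on_compose2[OF continuous_riemann_R[of UNIV]]) simp
qed

text \<open>
  Only the frequencies \<open>n\<^sup>2\<close> occur in \<open>R\<close>, so by \<open>riesz_coeff_square\<close> the integral picks out exactly the lacunary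
  frequencies. The series may be integrated term by term because it converges uniformly.
\<close>

lemma integral_riemann_R_riesz:
  "integral {0..2} (\<lambda>x. of_real (riemann_R (x + h) - riemann_R x) * riesz a K x) =
     \<i> * of_real (a * (\<Sum>k<K. sin (pi * real (lac_root k) ^ 2 * h) / real (lac_root k) ^ 2))"
proof -
  let ?S = "\<lambda>N x. \<Sum>n<N. sin (pi * real (Suc n) ^ 2 * x) / real (Suc n) ^ 2"
  define G where "G N = integral {0..2} (\<lambda>x. of_real (?S N (x + h) - ?S N x) * riesz a K x)" for N
  have G: "G N = (\<Sum>n\<in>{..<N} \<inter> {n. Suc n \<in> lac_root ` {..<K}}.
      \<i> * of_real (a * (sin (pi * real (Suc n) ^ 2 * h) / real (Suc n) ^ 2)))" for N
  proof -
    let ?g = "\<lambda>n \<theta> x. of_real (sin (pi * of_int (int (Suc n) ^ 2) * x + \<theta>)) * riesz a K x"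
    have "complex_of_real (?S N (x + h) - ?S N x) * riesz a K x =
        (\<Sum>n<N. of_real (1 / real (Suc n) ^ 2) * (?g n (pi * real (Suc n) ^ 2 * h) x - ?g n 0 x))" for x
      unfolding sum_subtractf[symmetric] of_real_sum sum_distrib_right
    proof (intro sum.cong refl)
      fix n
      define q where "q = real (Suc n)"
      have "of_int (int (Suc n) ^ 2) = q ^ 2"
        by (simp add: q_def)
      moreover have "pi * q ^ 2 * (x + h) = pi * q ^ 2 * x + pi * q ^ 2 * h"
        by (simp add: algebra_simps)
      ultimately show "complex_of_real (sin (pi * real (Suc n) ^ 2 * (x + h)) / real (Suc n) ^ 2
            - sin (pi * real (Suc n) ^ 2 * x) / real (Suc n) ^ 2) * riesz a K x
          = of_real (1 / real (Suc n) ^ 2) * (?g n (pi * real (Suc n) ^ 2 * h) x - ?g n 0 x)"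
        by (simp only: q_def[symmetric]) (simp add: left_diff_distrib diff_divide_distrib)
    qed
    then have "G N = (\<Sum>n<N. of_real (1 / real (Suc n) ^ 2) *
        (riesz_coeff a K (int (Suc n) ^ 2) (pi * real (Suc n) ^ 2 * h) - riesz_coeff a K (int (Suc n) ^ 2) 0))"
      unfolding G_def riesz_coeff_def
      by (simp only: integral_sum integral_mult_right integral_diff riesz_coeff_integrable
          integrable_on_mult_right integrable_diff finite_lessThan)
    also have "\<dots> = (\<Sum>n<N. if Suc n \<in> lac_root ` {..<K}
        then \<i> * of_real (a * (sin (pi * real (Suc n) ^ 2 * h) / real (Suc n) ^ 2)) else 0)"
      by (intro sum.cong refl) (simp add: riesz_coeff_square del: of_nat_Suc)
    finally show ?thesis
      by (simp only: sum.inter_restrict finite_lessThan mem_Collect_eq)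
  qed
  define L where "L = \<i> * complex_of_real (a * (\<Sum>k<K. sin (pi * real (lac_root k) ^ 2 * h) / real (lac_root k) ^ 2))"
  have "G N = L" if "N \<ge> lac_root K" for N
  proof -
    have "{..<N} \<inter> {n. Suc n \<in> lac_root ` {..<K}} = lac_deg ` {..<K}"
    proof -
      have "lac_deg k < N" if "k < K" for k
        using strict_monoD[OF strict_mono_lac_root that] \<open>N \<ge> lac_root K\<close> by (simp add: lac_root_def)
      moreover have "Suc n \<in> lac_root ` {..<K} \<longleftrightarrow> n \<in> lac_deg ` {..<K}" for n
        by (simp add: lac_root_def image_iff)
      ultimately show ?thesis
        by blast
    qed
    moreover have "inj_on lac_deg {..<K}"
    proof (rule inj_onI)
      fix i j assume "lac_deg i = lac_deg j"
      then have "lac_root i = lac_root j"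
        by (simp only: lac_root_def)
      then show "i = j"
        by (simp only: strict_mono_eq[OF strict_mono_lac_root])
    qed
    ultimately have "G N = (\<Sum>k<K. \<i> * of_real (a * (sin (pi * real (lac_root k) ^ 2 * h) / real (lac_root k) ^ 2)))"
      unfolding G by (simp add: sum.reindex lac_root_def)
    then show ?thesis
      by (simp only: L_def of_real_sum sum_distrib_left)
  qed
  then have "G \<longlonglongrightarrow> L"
    by (intro tendsto_eventually eventually_sequentiallyI)
  moreover have "G \<longlonglongrightarrow> integral {0..2} (\<lambda>x. of_real (riemann_R (x + h) - riemann_R x) * riesz a K x)"
  proof -
    have shift: "uniform_limit {0..2} (\<lambda>N x. ?S N (x + h)) (\<lambda>x. riemann_R (x + h)) sequentially"
      using uniform_limit_compose'[OF uniform_limit_riemann_R, of "\<lambda>x. x + h" "{0..2}"] by simp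
    have "uniform_limit {0..2} (\<lambda>N x. ?S N (x + h) - ?S N x) (\<lambda>x. riemann_R (x + h) - riemann_R x) sequentially"
      by (intro uniform_limit_minus shift uniform_limit_on_subset[OF uniform_limit_riemann_R]) simp
    then have "uniform_limit {0..2} (\<lambda>N x. complex_of_real (?S N (x + h) - ?S N x))
        (\<lambda>x. of_real (riemann_R (x + h) - riemann_R x)) sequentially"
      by (rule bounded_linear_uniform_limit_intros)
    then have "uniform_limit {0..2} (\<lambda>N x. complex_of_real (?S N (x + h) - ?S N x) * riesz a K x)
        (\<lambda>x. of_real (riemann_R (x + h) - riemann_R x) * riesz a K x) sequentially"
    proof (rule uniform_lim_mult[OF _ uniform_limit_const])
      show "bounded ((\<lambda>x. complex_of_real (riemann_R (x + h) - riemann_R x)) ` {0..2})"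
        by (intro compact_imp_bounded compact_continuous_image continuous_on_of_real
            continuous_riemann_R_difference compact_Icc)
      show "bounded (riesz a K ` {0..2})"
        by (intro compact_imp_bounded compact_continuous_image continuous_on_riesz compact_Icc)
    qed
    moreover have "continuous_on {0..2} (\<lambda>x. complex_of_real (?S N (x + h) - ?S N x) * riesz a K x)" for N
      by (intro continuous_intros continuous_on_riesz) simp_all
    ultimately obtain I J where I: "\<And>N. ((\<lambda>x. complex_of_real (?S N (x + h) - ?S N x) * riesz a K x) has_integral I N) {0..2}"
      and J: "((\<lambda>x. of_real (riemann_R (x + h) - riemann_R x) * riesz a K x) has_integral J) {0..2}"
      and "I \<longlonglongrightarrow> J"
      by (rule uniform_limit_integral) (rule sequentially_bot | blast)+
    moreover have "G = I"
      unfolding G_def by (rule ext) (rule integral_unique[OF I])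
    ultimately show ?thesis
      by (simp only: integral_unique[OF J])
  qed
  ultimately show ?thesis
    unfolding L_def[symmetric] by (rule LIMSEQ_unique[rotated])
qed

section \<open>The sine series is not of bounded variation\<close>

text \<open>
  The \<open>L\<^sup>1\<close> modulus of continuity of a function of bounded variation is linear in \<open>h\<close>. On the
  grid interval number \<open>j\<close> of length \<open>h\<close> the difference is at most the sum of the oscillations over
  the intervals number \<open>j\<close> and \<open>j + 1\<close>.
\<close>

lemma integral_difference_le:
  assumes W: "variation_le 1 (\<lambda>x. complex_of_real (riemann_R x)) 2 W" and "M > 0"
  defines "h \<equiv> 2 / real M"
  shows "integral {0..2} (\<lambda>x. \<bar>riemann_R (x + h) - riemann_R x\<bar>) \<le> 16 * W * h"
proof -
  let ?f = "\<lambda>x. complex_of_real (riemann_R x)"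
  define I where "I j = {real j * h..real (Suc j) * h}" for j
  define r where "r j = rosc ?f (I j)" for j
  define D where "D x = \<bar>riemann_R (x + h) - riemann_R x\<bar>" for x
  have h: "h > 0" "real M * h = 2"
    using \<open>M > 0\<close> by (simp_all add: h_def)
  have r0: "0 \<le> r j" for j
    by (simp add: r_def rosc_nonneg)
  have D_int: "D integrable_on {a..b}" for a b
    unfolding D_def
    by (intro integrable_continuous_interval continuous_intros continuous_riemann_R_difference)
  have D_le: "D x \<le> r j + r (Suc j)" if "x \<in> I j" for x j
  proof -
    let ?m = "real (Suc j) * h"
    have "x + h \<in> I (Suc j)" "?m \<in> I (Suc j)" "?m \<in> I j"
      using that h by (auto simp: I_def algebra_simps)
    then have "cmod (?f (x + h) - ?f ?m) \<le> r (Suc j)" "cmod (?f ?m - ?f x) \<le> r j"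
      unfolding r_def using that by (auto intro!: le_rosc[OF bounded_riemann_R])
    then have "\<bar>riemann_R (x + h) - riemann_R ?m\<bar> \<le> r (Suc j)" "\<bar>riemann_R ?m - riemann_R x\<bar> \<le> r j"
      by (simp_all only: of_real_diff[symmetric] norm_of_real)
    then show ?thesis
      unfolding D_def by linarith
  qed
  have int_le: "integral {0..real j * h} D \<le> (\<Sum>i<j. h * (r i + r (Suc i)))" for j
  proof (induction j)
    case (Suc j)
    have "integral (I j) D \<le> integral (I j) (\<lambda>x. r j + r (Suc j))"
      using D_le D_int by (intro integral_le) (auto simp: I_def)
    also have "\<dots> = h * (r j + r (Suc j))"
      using h by (simp add: I_def algebra_simps)
    finally have "integral (I j) D \<le> h * (r j + r (Suc j))" .
    moreover have "integral {0..real j * h} D + integral (I j) D = integral {0..real (Suc j) * h} D"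
      unfolding I_def using h D_int
      by (intro Henstock_Kurzweil_Integration.integral_combine) (auto simp: algebra_simps)
    ultimately show ?case
      using Suc by simp
  qed simp
  \<comment> \<open>Neighbouring closed grid intervals share an endpoint, so even and odd indices are treated as two families; they extend over two periods.\<close>
  have half: "(\<Sum>i<M. r (2 * i + e)) \<le> 4 * W" if "e \<le> 1" for e
  proof -
    define J where "J i = I (2 * i + e)" for i
    have disj: "J i \<inter> J j = {}" if "i < j" for i j
    proof -
      have "real (Suc (2 * i + e)) * h < real (2 * j + e) * h"
        using that h by (intro mult_strict_right_mono) auto
      then show ?thesis
        by (auto simp: J_def I_def)
    qed
    have ne: "J i \<noteq> {}" for i
      using h by (simp add: J_def I_def)
    have inj: "inj_on J {..<M}"
    proof (rule inj_onI)
      fix i j assume "J i = J j"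
      then show "i = j"
        using disj[of i j] disj[of j i] ne by (metis Int_absorb linorder_neqE_nat)
    qed
    have "J ` {..<M} \<in> interval_families {0..real 2 * 2}"
      unfolding interval_families_def
    proof (intro CollectI conjI ballI)
      show "disjoint (J ` {..<M})"
        using disj by (intro disjointI) (metis Int_commute imageE linorder_neqE_nat)
      fix S assume "S \<in> J ` {..<M}"
      then obtain i where i: "i < M" "S = J i" by blast
      show "is_interval S"
        by (simp add: i J_def I_def is_interval_cc)
      have "real (Suc (2 * i + e)) * h \<le> real (2 * M) * h"
        using i \<open>e \<le> 1\<close> h by (intro mult_right_mono) auto
      also have "real (2 * M) * h = 2 * (real M * h)"
        by simp
      finally have "real (Suc (2 * i + e)) * h \<le> 4"
        unfolding h(2) by simp
      moreover have "0 \<le> real (2 * i + e) * h"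
        using h by simp
      ultimately show "S \<subseteq> {0..real 2 * 2}"
        unfolding i J_def I_def by auto
    qed simp
    moreover have "variation_le 1 ?f (real 2 * 2) (2 * real 2 * W)"
      by (rule variation_le_periods[OF _ _ bounded_riemann_R W]) (auto simp: riemann_R_periodic)
    ultimately have "(\<Sum>S\<in>J ` {..<M}. rosc ?f S powr 1) \<le> 2 * real 2 * W"
      unfolding variation_le_def by blast
    also have "(\<Sum>S\<in>J ` {..<M}. rosc ?f S powr 1) = (\<Sum>i<M. r (2 * i + e))"
      by (subst sum.reindex[OF inj]) (simp add: rosc_nonneg r_def J_def)
    finally show ?thesis
      by simp
  qed
  have "(\<Sum>i<2 * m. r i) = (\<Sum>i<m. r (2 * i + 0)) + (\<Sum>i<m. r (2 * i + 1))" for m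
    by (induction m) auto
  then have all: "(\<Sum>i<2 * M. r i) \<le> 8 * W"
    using half[of 0] half[of 1] by simp
  have "(\<Sum>i<M. r i) \<le> (\<Sum>i<2 * M. r i)"
    using r0 by (intro sum_mono2) auto
  moreover have "(\<Sum>i<M. r (Suc i)) \<le> (\<Sum>i<2 * M. r i)"
  proof -
    have "(\<Sum>i<M. r (Suc i)) \<le> (\<Sum>i<Suc M. r i)"
      using r0[of 0] by (simp add: sum.lessThan_Suc_shift del: sum.lessThan_Suc)
    also have "\<dots> \<le> (\<Sum>i<2 * M. r i)"
      using r0 \<open>M > 0\<close> by (intro sum_mono2) auto
    finally show ?thesis .
  qed
  ultimately have "h * ((\<Sum>i<M. r i) + (\<Sum>i<M. r (Suc i))) \<le> h * (16 * W)"
    using all h by (intro mult_left_mono) auto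
  moreover have "integral {0..2} D \<le> h * ((\<Sum>i<M. r i) + (\<Sum>i<M. r (Suc i)))"
    using int_le[of M] h by (simp add: sum.distrib sum_distrib_left distrib_left)
  ultimately show ?thesis
    unfolding D_def by (simp add: mult_ac)
qed

text \<open>
  Pairing the difference quotient of \<open>R\<close> with the bounded Riesz product gives a quantity bounded
  by a multiple of the variation. As \<open>h\<close> tends to \<open>0\<close>, each of the \<open>K\<close> lacunary frequencies
  contributes \<open>\<pi>/\<surd>K\<close>, and the total \<open>\<pi>\<surd>K\<close> is unbounded in \<open>K\<close>.
\<close>

lemma riemann_R_not_bounded_variation:
  "\<not> variation_le 1 (\<lambda>x. complex_of_real (riemann_R x)) 2 W"
proof
  assume W: "variation_le 1 (\<lambda>x. complex_of_real (riemann_R x)) 2 W"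
  have bound: "pi * sqrt (real K) \<le> 32 * W" if "K > 0" for K
  proof -
    define a where "a = 1 / sqrt (real K)"
    have a: "a > 0" "a ^ 2 = 1 / real K"
      using that by (simp_all add: a_def power_divide)
    have Q: "cmod (riesz a K x) \<le> 2" for x
    proof -
      have "cmod (riesz a K x) ^ 2 \<le> (1 + 1 / real K) ^ K"
        using norm_riesz_le[of a K x] a by simp
      also have "\<dots> \<le> exp 1"
        using that by (intro exp_ge_one_plus_x_over_n_power_n) auto
      also have "\<dots> \<le> 2 ^ 2"
        using exp_le by simp
      finally show ?thesis
        by (rule power2_le_imp_le) simp
    qed
    define s where "s h = a * (\<Sum>k<K. sin (pi * real (lac_root k) ^ 2 * h) / real (lac_root k) ^ 2)" for h
    have s_le: "s (2 / real M) / (2 / real M) \<le> 32 * W" if "M > 0" for M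
    proof -
      define h where "h = 2 / real M"
      have h: "h > 0"
        using that by (simp add: h_def)
      have "s h \<le> cmod (\<i> * complex_of_real (s h))"
        by (simp add: norm_mult)
      also have "\<dots> = cmod (integral {0..2} (\<lambda>x. of_real (riemann_R (x + h) - riemann_R x) * riesz a K x))"
        by (simp only: integral_riemann_R_riesz s_def)
      also have "\<dots> \<le> integral {0..2} (\<lambda>x. 2 * \<bar>riemann_R (x + h) - riemann_R x\<bar>)"
      proof (rule integral_norm_bound_integral)
        show "(\<lambda>x. complex_of_real (riemann_R (x + h) - riemann_R x) * riesz a K x) integrable_on {0..2}"
          by (intro integrable_continuous_interval continuous_on_mult continuous_on_of_real
              continuous_riemann_R_difference continuous_on_riesz)
        show "(\<lambda>x. 2 * \<bar>riemann_R (x + h) - riemann_R x\<bar>) integrable_on {0..2}"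
          by (intro integrable_continuous_interval continuous_intros continuous_riemann_R_difference)
        fix x
        show "cmod (complex_of_real (riemann_R (x + h) - riemann_R x) * riesz a K x)
            \<le> 2 * \<bar>riemann_R (x + h) - riemann_R x\<bar>"
          using mult_left_mono[OF Q[of x], of "\<bar>riemann_R (x + h) - riemann_R x\<bar>"]
          by (simp only: norm_mult norm_of_real) (simp add: mult.commute)
      qed
      also have "\<dots> = 2 * integral {0..2} (\<lambda>x. \<bar>riemann_R (x + h) - riemann_R x\<bar>)"
        by simp
      also have "\<dots> \<le> 2 * (16 * W * h)"
        unfolding h_def using integral_difference_le[OF W that] by (intro mult_left_mono) auto
      finally show ?thesis
        unfolding h_def[symmetric] using h by (simp add: divide_le_eq)
    qed
    have "((\<lambda>h. s h / h) \<longlongrightarrow> pi * sqrt (real K)) (at 0)"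
    proof -
      have "((\<lambda>h. sin (pi * q ^ 2 * h) / q ^ 2) has_real_derivative pi) (at 0)" if "q \<noteq> 0" for q :: real
        using that by (auto intro!: derivative_eq_intros simp: power2_eq_square power4_eq_xxxx)
      then have "(s has_real_derivative a * (\<Sum>k<K. pi)) (at 0)"
        unfolding s_def by (intro DERIV_cmult DERIV_sum) (simp add: lac_root_def)
      also have "a * (\<Sum>k<K. pi) = pi * sqrt (real K)"
        using that by (simp add: a_def real_div_sqrt field_simps)
      finally have "(s has_real_derivative pi * sqrt (real K)) (at 0)" .
      moreover have "s 0 = 0"
        by (simp add: s_def)
      ultimately show ?thesis
        by (simp add: DERIV_def)
    qed
    moreover have "filterlim (\<lambda>M. 2 / real (Suc M)) (at 0) sequentially"
    proof (rule filterlim_atI)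
      show "(\<lambda>M. 2 / real (Suc M)) \<longlonglongrightarrow> 0"
        using LIMSEQ_Suc[OF lim_const_over_n[of 2]] by simp
    qed simp
    ultimately have "(\<lambda>M. s (2 / real (Suc M)) / (2 / real (Suc M))) \<longlonglongrightarrow> pi * sqrt (real K)"
      by (rule filterlim_compose)
    then show ?thesis
      by (rule LIMSEQ_le_const2) (use s_le in blast)
  qed
  obtain n where n: "32 * W < real n"
    using reals_Archimedean2 by blast
  have "32 * W < real (Suc n)"
    using n by simp
  also have "\<dots> \<le> pi * sqrt (real (Suc n ^ 2))"
    using pi_ge_two mult_right_mono[of 1 pi "real (Suc n)"] by (simp del: of_nat_Suc)
  also have "\<dots> \<le> 32 * W"
    by (rule bound) simp
  finally show False by simp
qed

section \<open>Equivalence of the two finiteness conditions\<close>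

theorem theorem1p1:
  fixes p :: real
  assumes "p \<ge> 1"
  shows "p_variation p riemann_Phi 2 < \<infinity>
           \<longleftrightarrow> p_variation p (\<lambda>x. complex_of_real (riemann_R x)) 2 < \<infinity>"
proof -
  let ?R = "\<lambda>x. complex_of_real (riemann_R x)"
  let ?C = "\<lambda>x. complex_of_real (riemann_C x)"
  have "\<exists>V. variation_le p ?R 2 V" if "variation_le p riemann_Phi 2 W" for W
  proof
    have "rosc ?R I powr p \<le> pi powr p * rosc riemann_Phi I powr p" for I
    proof -
      have "rosc ?R I \<le> pi * rosc riemann_Phi I"
      proof (rule rosc_le)
        fix x y assume "x \<in> I" "y \<in> I"
        have "?R x - ?R y = of_real (Re (of_real pi * (riemann_Phi x - riemann_Phi y)))"
          by (simp add: riemann_Phi_eq field_simps)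
        then have "cmod (?R x - ?R y) \<le> cmod (of_real pi * (riemann_Phi x - riemann_Phi y))"
          using abs_Re_le_cmod by (metis norm_of_real)
        also have "\<dots> = pi * cmod (riemann_Phi x - riemann_Phi y)"
          by (simp add: norm_mult)
        also have "\<dots> \<le> pi * rosc riemann_Phi I"
          using \<open>x \<in> I\<close> \<open>y \<in> I\<close> by (intro mult_left_mono le_rosc[OF bounded_riemann_Phi]) auto
        finally show "cmod (?R x - ?R y) \<le> pi * rosc riemann_Phi I" .
      qed (simp add: rosc_nonneg)
      then have "rosc ?R I powr p \<le> (pi * rosc riemann_Phi I) powr p"
        using assms by (intro powr_mono2) (auto simp: rosc_nonneg)
      then show ?thesis
        by (simp add: powr_mult rosc_nonneg)
    qed
    then have "(\<Sum>I\<in>\<I>. rosc ?R I powr p) \<le> pi powr p * (\<Sum>I\<in>\<I>. rosc riemann_Phi I powr p)" for \<I>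
      unfolding sum_distrib_left by (rule sum_mono)
    moreover have "pi powr p * (\<Sum>I\<in>\<I>. rosc riemann_Phi I powr p) \<le> pi powr p * W"
      if "\<I> \<in> interval_families {0..2}" for \<I>
      using \<open>variation_le p riemann_Phi 2 W\<close> that
      unfolding variation_le_def by (intro mult_left_mono) auto
    ultimately show "variation_le p ?R 2 (pi powr p * W)"
      unfolding variation_le_def using order_trans by blast
  qed
  moreover have "\<exists>V. variation_le p riemann_Phi 2 V" if W: "variation_le p ?R 2 W" for W
  proof -
    have "p \<noteq> 1"
      using W riemann_R_not_bounded_variation by blast
    then obtain V where V: "variation_le p ?C 2 V"
      using variation_riemann_C[OF _ W] assms by force
    have le: "rosc riemann_Phi I powr p \<le> 2 powr (p - 1) * (rosc ?R I powr p + rosc ?C I powr p)" for I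
    proof -
      have "rosc riemann_Phi I \<le> cmod (1 / of_real pi) * rosc ?R I + cmod (- \<i> / of_real pi) * rosc ?C I"
        by (rule rosc_linear_combination_le[OF bounded_riemann_R bounded_riemann_C])
          (simp add: riemann_Phi_eq diff_divide_distrib)
      also have "\<dots> = (rosc ?R I + rosc ?C I) / pi"
        by (simp add: norm_divide add_divide_distrib)
      also have "\<dots> \<le> (rosc ?R I + rosc ?C I) / 1"
        using pi_ge_two by (intro divide_left_mono) (auto simp: rosc_nonneg)
      finally have "rosc riemann_Phi I powr p \<le> (rosc ?R I + rosc ?C I) powr p"
        using assms by (intro powr_mono2) (auto simp: rosc_nonneg)
      also have "\<dots> \<le> 2 powr (p - 1) * (rosc ?R I powr p + rosc ?C I powr p)"
        using assms by (intro powr_add_le) (auto simp: rosc_nonneg)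
      finally show ?thesis .
    qed
    have "(\<Sum>I\<in>\<I>. rosc riemann_Phi I powr p) \<le> 2 powr (p - 1) * (W + V)"
      if "\<I> \<in> interval_families {0..2}" for \<I>
    proof -
      have "(\<Sum>I\<in>\<I>. rosc riemann_Phi I powr p)
          \<le> 2 powr (p - 1) * ((\<Sum>I\<in>\<I>. rosc ?R I powr p) + (\<Sum>I\<in>\<I>. rosc ?C I powr p))"
        unfolding sum.distrib[symmetric] sum_distrib_left by (rule sum_mono) (rule le)
      also have "\<dots> \<le> 2 powr (p - 1) * (W + V)"
        using W V that unfolding variation_le_def by (intro mult_left_mono add_mono) auto
      finally show ?thesis .
    qed
    then show ?thesis
      unfolding variation_le_def by blast
  qed
  ultimately show ?thesis
    unfolding p_variation_finite_iff[OF bounded_riemann_Phi assms]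
      p_variation_finite_iff[OF bounded_riemann_R assms] by blast
qed

end
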